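(* Run the adaptive prox-convex algorithm described in the context with $0<\alpha_1<\alpha_2<1$, $\nu_{\rm inc}>1$, $\nu_{\rm dec}\in(0,1)$, $\mu_0>0$ and $\mu_{\min}>0$. Let $Q_k=\mu_kI+H_k^+$, where $H_k^+$ is constructed as in the context, and let $L_U:=L_h\beta_C+L_R^2\beta_s$. Then there exist constants $0<\underline q\le\overline q<\infty$, independent of $k$, such that $$\underline q\,I\ \preceq\ Q_k\ \preceq\ \overline q\,I\qquad\text{for all }k,$$ with $$\underline q:=\min\{\mu_0,\mu_{\min}\},\qquad \overline q:=\max\Big\{\mu_0,\ \frac{\nu_{\rm inc}L_U}{2-\alpha_1}\Big\}+\overline h,$$ and the curvature cap $$\overline h:=\beta_CL_h+\beta_sL_R^2+L_s\beta_R .$$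
   Context: **Problem.** $F(x)=g(x)+h(C(x))+s(R(x))$ on $\mathbb R^m$, where $g:\mathbb R^m\to\mathbb R\cup\{+\infty\}$ is proper, closed, convex; $h:\mathbb R^d\to\mathbb R$ is finite-valued, closed, convex; $C:\mathbb R^m\to\mathbb R^d$ and $s:\mathbb R^n\to\mathbb R$ are $\mathcal C^1$; $R=(r_1,\dots,r_n)$ with each $r_i:\mathbb R^m\to\mathbb R$ finite-valued, closed, convex. $\|\cdot\|$ is the Euclidean norm on vectors and the spectral norm on matrices; $\|u\|_Q^2:=u^\top Qu$. **Standing assumptions.** (1) Monotone-or-smooth: for each $\bar x\in\operatorname{dom}F$ there is a neighborhood $W$ of $R(\bar x)$ such that, for every $i$, if $r_i$ is not $\mathcal C^1$ on any neighborhood of $\bar x$ then $\nabla_i s(z)\ge0$ for all $z\in W$. (2) A starting point $x_0\in\operatorname{dom}F$ is fixed, and $\mathcal X_0:=\{x\in\operatorname{dom}F: F(x)\le F(x_0)\}$ is nonempty and compact. (3) $h$ is $L_h$-Lipschitz; $C$ has $\beta_C$-Lipschitz Jacobian; $s$ has $\beta_s$-Lipschitz gradient; each $r_i$ is $L_{r_i}$-Lipschitz, and $L_R:=\|(L_{r_1},\dots,L_{r_n})\|_2$. (4) Let $\mathcal I^-$ be the set of indices $i$ with $\nabla_i s(R(x))<0$ for some $x\in\mathcal X_0$ (the components that are ever linearized on the level set). If $\mathcal I^-\ne\emptyset$, then $\|\nabla s(y)\|\le L_s$ for all $y\in\{R(x):F(x)\le F(x_0)\}$, and each $r_i$, $i\in\mathcal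 I^-$, is $\mathcal C^1$ with $\beta_{r_i}$-Lipschitz gradient; $\beta_R:=(\sum_{i\in\mathcal I^-}\beta_{r_i}^2)^{1/2}$. If $\mathcal I^-=\emptyset$, then $\beta_R=0$ (empty sum) and $L_s\beta_R$ is read as $0$. **Model.** $$F(x;x_k)=g(x)+h\big(C(x_k)+\nabla C(x_k)(x-x_k)\big)+s(R(x_k))+\sum_{i=1}^n\nabla_i s(R(x_k))\,\Phi_i(x;x_k),$$ where $\Phi_i(x;x_k)=r_i(x)-r_i(x_k)$ if $\nabla_i s(R(x_k))\ge0$, and $\Phi_i(x;x_k)=\nabla r_i(x_k)^\top(x-x_k)$ if $\nabla_i s(R(x_k))<0$. The proximal model is $F_{Q}(x;x_k)=F(x;x_k)+\tfrac12\|x-x_k\|_{Q}^2$. **Curvature block.** $H_k^+:=\Pi_{\mathbb S_+}(H_{C,k}+H_{s,k})$, where $\Pi_{\mathbb S_+}$ is the projection onto the cone of positive semidefinite matrices. Here $H_{C,k}=\sum_{j=1}^d y_j\nabla^2C_j(x_k)$ with some $y\in\partial h(C(x_k))$ if $C$ is $\mathcal C^2$ (and its Hessians are tractable), and $H_{C,k}=0$ otherwise. If $s$ is $\mathcal C^2$ (and the required Hessians are available), $H_{s,k}=G_R(x_k)^\top\nabla^2s(R(x_k))G_R(x_k)+\sum_i\nabla_is(R(x_k))\nabla^2r_i(x_k)$, where $G_R(x_k)$ has rows $g_{i,k}^\top$ with $g_{i,k}\in\partial r_i(x_k)$ and the sum is over indices $i$ with $\nabla_is(R(x_k))<0$ and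 $r_i\in\mathcal C^2$ with tractable Hessian; otherwise $H_{s,k}=0$. **Algorithm.** Input $x_0$, $\mu_0>0$, $\mu_{\min}>0$, $0<\alpha_1<\alpha_2<1$, $\nu_{\rm inc}>1>\nu_{\rm dec}>0$, and a termination tolerance $\epsilon_{\rm term}$. For $k=0,1,2,\dots$: build $H_k^+\succeq0$. Repeat: set $Q_k=\mu_kI+H_k^+$; $x_k^+=\arg\min_xF_{Q_k}(x;x_k)$; $\mathrm{Pred}_k=F(x_k)-F_{Q_k}(x_k^+;x_k)$; $\mathrm{Act}_k=F(x_k)-F(x_k^+)$; if $\mathrm{Pred}_k=0$ or $\|Q_k(x_k-x_k^+)\|\le\epsilon_{\rm term}$, terminate and return $x_k$; set $\rho_k=\mathrm{Act}_k/\mathrm{Pred}_k$; if $\rho_k<\alpha_1$ (rejection), set $\mu_k\leftarrow\nu_{\rm inc}\mu_k$; until $\rho_k\ge\alpha_1$ (acceptance). Then $x_{k+1}=x_k^+$, and $\mu_{k+1}=\max\{\mu_{\min},\nu_{\rm dec}\mu_k\}$ if $\rho_k>\alpha_2$, $\mu_{k+1}=\mu_k$ otherwise.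
   Formalization: The stated upper constant fails when μ_min > max{μ_0, ν_inc L_U/(2−α_1)}, since a very successful step can reset μ to μ_min; it is proved when μ_min is at most that maximum, and in general with μ_min added inside the maximum. *)

theory Defs
  imports "HOL-Analysis.Analysis"
begin

section \<open>Convex analysis\<close>

definition proper_fun :: "('a \<Rightarrow> ereal) \<Rightarrow> bool" where
  "proper_fun f \<longleftrightarrow> (\<forall>x. f x \<noteq> -\<infinity>) \<and> (\<exists>x. f x \<noteq> \<infinity>)"

definition edom :: "('a \<Rightarrow> ereal) \<Rightarrow> 'a set" where
  "edom f = {x. f x < \<infinity>}"

text \<open>The library's \<^const>\<open>epigraph\<close> is for real-valued functions only.\<close>

definition ereal_epigraph :: "('a \<Rightarrow> ereal) \<Rightarrow> ('a \<times> real) set" where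
  "ereal_epigraph f = {(x, t). f x \<le> ereal t}"

definition proper_closed_convex :: "('a::real_normed_vector \<Rightarrow> ereal) \<Rightarrow> bool" where
  "proper_closed_convex f \<longleftrightarrow>
     proper_fun f \<and> closed (ereal_epigraph f) \<and> convex (ereal_epigraph f)"

definition finite_closed_convex :: "('a::real_normed_vector \<Rightarrow> real) \<Rightarrow> bool" where
  "finite_closed_convex f \<longleftrightarrow> closed (epigraph UNIV f) \<and> convex_on UNIV f"

definition subdifferential :: "('a::real_inner \<Rightarrow> real) \<Rightarrow> 'a \<Rightarrow> 'a set" where
  "subdifferential f x = {v. \<forall>z. f z \<ge> f x + v \<bullet> (z - x)}"


section \<open>Smoothness\<close>

text \<open>
  The Frechet derivative as an element of the space of bounded linear maps. The norm there is
  the operator norm, i.e. the spectral norm of the Jacobian; the norm of the type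
  \<open>real ^ 'm ^ 'd\<close> would be the Frobenius norm.
\<close>

definition deriv_op ::
  "('a::real_normed_vector \<Rightarrow> 'b::real_normed_vector) \<Rightarrow> 'a \<Rightarrow> 'a \<Rightarrow>\<^sub>L 'b" where
  "deriv_op f x = Blinfun (frechet_derivative f (at x))"

definition C1_on :: "'a::real_normed_vector set \<Rightarrow> ('a \<Rightarrow> 'b::real_normed_vector) \<Rightarrow> bool" where
  "C1_on S f \<longleftrightarrow> (\<forall>x\<in>S. f differentiable (at x)) \<and> continuous_on S (deriv_op f)"

definition C2_on :: "'a::real_normed_vector set \<Rightarrow> ('a \<Rightarrow> 'b::real_normed_vector) \<Rightarrow> bool" where
  "C2_on S f \<longleftrightarrow> C1_on S f \<and> C1_on S (deriv_op f)"

definition grad :: "('a::real_inner \<Rightarrow> real) \<Rightarrow> 'a \<Rightarrow> 'a" where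
  "grad f x = (THE v. GDERIV f x :> v)"

definition hessian :: "(real^'n \<Rightarrow> real) \<Rightarrow> real^'n \<Rightarrow> real^'n^'n" where
  "hessian f x = jacobian (grad f) (at x)"


section \<open>Positive semidefinite matrices\<close>

definition psd_cone :: "(real^'m^'m) set" where
  "psd_cone = {A. transpose A = A \<and> (\<forall>v. 0 \<le> v \<bullet> (A *v v))}"

definition loewner_le :: "real^'m^'m \<Rightarrow> real^'m^'m \<Rightarrow> bool"  (infix \<open>\<preceq>\<^sub>L\<close> 50) where
  "A \<preceq>\<^sub>L B \<longleftrightarrow> B - A \<in> psd_cone"

text \<open>
  The distance of the matrix type is the Frobenius distance, so \<^const>\<open>closest_point\<close> is the
  usual projection onto the cone.
\<close>

definition psd_proj :: "real^'m^'m \<Rightarrow> real^'m^'m" where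
  "psd_proj A = closest_point psd_cone A"


section \<open>The objective and its prox-convex model\<close>

definition inner_map :: "('n \<Rightarrow> real^'m \<Rightarrow> real) \<Rightarrow> real^'m \<Rightarrow> real^'n" where
  "inner_map r x = (\<chi> i. r i x)"

definition objective ::
  "(real^'m \<Rightarrow> ereal) \<Rightarrow> (real^'d \<Rightarrow> real) \<Rightarrow> (real^'m \<Rightarrow> real^'d) \<Rightarrow> (real^'n \<Rightarrow> real) \<Rightarrow>
   ('n \<Rightarrow> real^'m \<Rightarrow> real) \<Rightarrow> real^'m \<Rightarrow> ereal" where
  "objective g h C s r x = g x + ereal (h (C x) + s (inner_map r x))"

definition level_set :: "('a \<Rightarrow> ereal) \<Rightarrow> 'a \<Rightarrow> 'a set" where
  "level_set F x0 = {x \<in> edom F. F x \<le> F x0}"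

definition monotone_or_smooth ::
  "(real^'m \<Rightarrow> ereal) \<Rightarrow> (real^'n \<Rightarrow> real) \<Rightarrow> ('n \<Rightarrow> real^'m \<Rightarrow> real) \<Rightarrow> bool" where
  "monotone_or_smooth F s r \<longleftrightarrow>
     (\<forall>xbar \<in> edom F. \<exists>W. open W \<and> inner_map r xbar \<in> W \<and>
        (\<forall>i. \<not> (\<exists>U. open U \<and> xbar \<in> U \<and> C1_on U (r i)) \<longrightarrow> (\<forall>z\<in>W. grad s z $ i \<ge> 0)))"

definition neg_indices ::
  "(real^'m) set \<Rightarrow> (real^'n \<Rightarrow> real) \<Rightarrow> ('n \<Rightarrow> real^'m \<Rightarrow> real) \<Rightarrow> 'n set" where
  "neg_indices X s r = {i. \<exists>x\<in>X. grad s (inner_map r x) $ i < 0}"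

definition partial_lin ::
  "(real^'n \<Rightarrow> real) \<Rightarrow> ('n \<Rightarrow> real^'m \<Rightarrow> real) \<Rightarrow> real^'m \<Rightarrow> 'n \<Rightarrow> real^'m \<Rightarrow> real" where
  "partial_lin s r xk i x =
     (if grad s (inner_map r xk) $ i \<ge> 0 then r i x - r i xk else grad (r i) xk \<bullet> (x - xk))"

definition model ::
  "(real^'m \<Rightarrow> ereal) \<Rightarrow> (real^'d \<Rightarrow> real) \<Rightarrow> (real^'m \<Rightarrow> real^'d) \<Rightarrow> (real^'n \<Rightarrow> real) \<Rightarrow>
   ('n \<Rightarrow> real^'m \<Rightarrow> real) \<Rightarrow> real^'m \<Rightarrow> real^'m \<Rightarrow> ereal" where
  "model g h C s r xk x =
     g x + ereal (h (C xk + jacobian C (at xk) *v (x - xk)) + s (inner_map r xk)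
                  + (\<Sum>i\<in>UNIV. grad s (inner_map r xk) $ i * partial_lin s r xk i x))"

definition prox_model ::
  "(real^'m \<Rightarrow> ereal) \<Rightarrow> (real^'d \<Rightarrow> real) \<Rightarrow> (real^'m \<Rightarrow> real^'d) \<Rightarrow> (real^'n \<Rightarrow> real) \<Rightarrow>
   ('n \<Rightarrow> real^'m \<Rightarrow> real) \<Rightarrow> real^'m^'m \<Rightarrow> real^'m \<Rightarrow> real^'m \<Rightarrow> ereal" where
  "prox_model g h C s r Q xk x =
     model g h C s r xk x + ereal (1/2 * ((x - xk) \<bullet> (Q *v (x - xk))))"


section \<open>The curvature block\<close>

text \<open>
  The flags \<open>tC\<close> and \<open>ts\<close> and the index set \<open>Tr\<close> record for which of \<open>C\<close>, \<open>s\<close>, \<open>r i\<close> the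
  Hessians are tractable. The subgradients are free choices, hence the blocks that may be built
  at \<open>x\<close> form a set.
\<close>

definition C_blocks ::
  "bool \<Rightarrow> (real^'d \<Rightarrow> real) \<Rightarrow> (real^'m \<Rightarrow> real^'d) \<Rightarrow> real^'m \<Rightarrow> (real^'m^'m) set" where
  "C_blocks tC h C x =
     (if C2_on UNIV C \<and> tC
      then {\<Sum>j\<in>UNIV. (y $ j) *\<^sub>R hessian (\<lambda>z. C z $ j) x | y. y \<in> subdifferential h (C x)}
      else {0})"

definition s_blocks ::
  "bool \<Rightarrow> 'n set \<Rightarrow> (real^'n \<Rightarrow> real) \<Rightarrow> ('n \<Rightarrow> real^'m \<Rightarrow> real) \<Rightarrow> real^'m \<Rightarrow>
   (real^'m^'m) set" where
  "s_blocks ts Tr s r x =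
     (if C2_on UNIV s \<and> ts
      then {transpose G ** hessian s (inner_map r x) ** G
              + (\<Sum>i\<in>{i \<in> Tr. grad s (inner_map r x) $ i < 0 \<and> C2_on UNIV (r i)}.
                    (grad s (inner_map r x) $ i) *\<^sub>R hessian (r i) x)
            | G :: real^'m^'n. \<forall>i. row i G \<in> subdifferential (r i) x}
      else {0})"

definition curvature_blocks ::
  "bool \<Rightarrow> bool \<Rightarrow> 'n set \<Rightarrow> (real^'d \<Rightarrow> real) \<Rightarrow> (real^'m \<Rightarrow> real^'d) \<Rightarrow> (real^'n \<Rightarrow> real) \<Rightarrow>
   ('n \<Rightarrow> real^'m \<Rightarrow> real) \<Rightarrow> real^'m \<Rightarrow> (real^'m^'m) set" where
  "curvature_blocks tC ts Tr h C s r x =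
     {psd_proj (HC + Hs) | HC Hs. HC \<in> C_blocks tC h C x \<and> Hs \<in> s_blocks ts Tr s r x}"


section \<open>The algorithm\<close>

definition Pred ::
  "(real^'m \<Rightarrow> ereal) \<Rightarrow> (real^'d \<Rightarrow> real) \<Rightarrow> (real^'m \<Rightarrow> real^'d) \<Rightarrow> (real^'n \<Rightarrow> real) \<Rightarrow>
   ('n \<Rightarrow> real^'m \<Rightarrow> real) \<Rightarrow> real^'m^'m \<Rightarrow> real^'m \<Rightarrow> real^'m \<Rightarrow> ereal" where
  "Pred g h C s r Q x xp = objective g h C s r x - prox_model g h C s r Q x xp"

definition Act ::
  "(real^'m \<Rightarrow> ereal) \<Rightarrow> (real^'d \<Rightarrow> real) \<Rightarrow> (real^'m \<Rightarrow> real^'d) \<Rightarrow> (real^'n \<Rightarrow> real) \<Rightarrow>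
   ('n \<Rightarrow> real^'m \<Rightarrow> real) \<Rightarrow> real^'m \<Rightarrow> real^'m \<Rightarrow> ereal" where
  "Act g h C s r x xp = objective g h C s r x - objective g h C s r xp"

text \<open>
  One nonterminating pass through the body of the inner loop at iterate \<open>x\<close>, with trial point
  \<open>xp\<close> and acceptance ratio \<open>\<rho>\<close>.
\<close>

definition trial_step ::
  "(real^'m \<Rightarrow> ereal) \<Rightarrow> (real^'d \<Rightarrow> real) \<Rightarrow> (real^'m \<Rightarrow> real^'d) \<Rightarrow> (real^'n \<Rightarrow> real) \<Rightarrow>
   ('n \<Rightarrow> real^'m \<Rightarrow> real) \<Rightarrow> real \<Rightarrow> real^'m^'m \<Rightarrow> real^'m \<Rightarrow> real^'m \<Rightarrow> ereal \<Rightarrow> bool" where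
  "trial_step g h C s r eps_term Q x xp \<rho> \<longleftrightarrow>
     is_arg_min (prox_model g h C s r Q x) (\<lambda>_. True) xp \<and>
     \<not> (Pred g h C s r Q x xp = 0 \<or> norm (Q *v (x - xp)) \<le> eps_term) \<and>
     \<rho> = Act g h C s r x xp / Pred g h C s r Q x xp"

text \<open>
  \<open>pc_trial \<dots> k x \<mu> H Q\<close>: some run of the algorithm, in outer iteration \<open>k\<close> with iterate \<open>x\<close>
  and curvature block \<open>H\<close>, enters the body of the inner loop with parameter \<open>\<mu>\<close> and sets
  \<open>Q\<^sub>k = Q\<close>. Every value ever taken by \<open>Q\<^sub>k\<close>, accepted or rejected, is covered.
\<close>

inductive pc_trial ::
  "(real^'m \<Rightarrow> ereal) \<Rightarrow> (real^'d \<Rightarrow> real) \<Rightarrow> (real^'m \<Rightarrow> real^'d) \<Rightarrow> (real^'n \<Rightarrow> real) \<Rightarrow>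
   ('n \<Rightarrow> real^'m \<Rightarrow> real) \<Rightarrow> bool \<Rightarrow> bool \<Rightarrow> 'n set \<Rightarrow> real^'m \<Rightarrow>
   real \<Rightarrow> real \<Rightarrow> real \<Rightarrow> real \<Rightarrow> real \<Rightarrow> real \<Rightarrow> real \<Rightarrow>
   nat \<Rightarrow> real^'m \<Rightarrow> real \<Rightarrow> real^'m^'m \<Rightarrow> real^'m^'m \<Rightarrow> bool"
  for g h C s r tC ts Tr x0 \<mu>0 \<mu>_min \<alpha>1 \<alpha>2 \<nu>_inc \<nu>_dec eps_term where
  start:
    "H \<in> curvature_blocks tC ts Tr h C s r x0 \<Longrightarrow>
     pc_trial g h C s r tC ts Tr x0 \<mu>0 \<mu>_min \<alpha>1 \<alpha>2 \<nu>_inc \<nu>_dec eps_term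
       0 x0 \<mu>0 H (mat \<mu>0 + H)"
| reject:
    "\<lbrakk>pc_trial g h C s r tC ts Tr x0 \<mu>0 \<mu>_min \<alpha>1 \<alpha>2 \<nu>_inc \<nu>_dec eps_term k x \<mu> H Q;
      trial_step g h C s r eps_term Q x xp \<rho>;
      \<rho> < ereal \<alpha>1;
      \<mu>' = \<nu>_inc * \<mu>\<rbrakk> \<Longrightarrow>
     pc_trial g h C s r tC ts Tr x0 \<mu>0 \<mu>_min \<alpha>1 \<alpha>2 \<nu>_inc \<nu>_dec eps_term
       k x \<mu>' H (mat \<mu>' + H)"
| accept:
    "\<lbrakk>pc_trial g h C s r tC ts Tr x0 \<mu>0 \<mu>_min \<alpha>1 \<alpha>2 \<nu>_inc \<nu>_dec eps_term k x \<mu> H Q;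
      trial_step g h C s r eps_term Q x xp \<rho>;
      \<rho> \<ge> ereal \<alpha>1;
      \<mu>' = (if \<rho> > ereal \<alpha>2 then max \<mu>_min (\<nu>_dec * \<mu>) else \<mu>);
      H' \<in> curvature_blocks tC ts Tr h C s r xp\<rbrakk> \<Longrightarrow>
     pc_trial g h C s r tC ts Tr x0 \<mu>0 \<mu>_min \<alpha>1 \<alpha>2 \<nu>_inc \<nu>_dec eps_term
       (Suc k) xp \<mu>' H' (mat \<mu>' + H')"

end

theory Submission
  imports Defs
begin

text \<open>
  Every matrix used by the algorithm is \<open>mat \<mu> + H\<close> with \<open>H\<close> a projected curvature block, so the
  bounds split into bounds for \<open>H\<close> and bounds for \<open>\<mu>\<close>.

  \<^emph>\<open>The block.\<close> \<open>H\<close> is positive semidefinite because it is a projection onto that cone. For the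
  upper bound, the projection does not raise an upper bound \<open>c \<ge> 0\<close> of the quadratic form
  (\<open>psd_proj_quadratic_le\<close>), so it is enough to bound the form of the matrix that is projected. A
  Hessian form is a second derivative along a line, hence bounded by a Lipschitz constant of the
  first derivative: the part from \<open>C\<close> gives \<open>L_h * \<beta>_C\<close>, because subgradients of \<open>h\<close> have norm at
  most \<open>L_h\<close>; the part from the Hessian of \<open>s\<close> gives \<open>\<beta>_s * L_R\<^sup>2\<close>, because the rows of the matrix of
  subgradients have norm at most \<open>L_r i\<close>. A linearized component enters with negative weight (a partial derivative of \<open>s\<close>)
  and a convex \<open>r i\<close>, so it can only lower the form (\<open>curvature_block_bound\<close>).

  \<^emph>\<open>The parameter.\<close> It starts at \<open>\<mu>0\<close>, grows on rejection, and after an acceptance is at least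
  \<open>\<mu>_min\<close> or unchanged, which gives the lower bound. From above, a rejection can only happen while
  \<open>(2 - \<alpha>1) * \<mu> < L_U\<close>, so that it never produces more than \<open>\<nu>_inc * L_U / (2 - \<alpha>1)\<close>. Indeed, with
  step \<open>d\<close> and \<open>q = d \<bullet> (Q *v d)\<close>, convexity of the model gives \<open>Pred \<ge> q / 2\<close>
  (\<open>prox_step_decrease\<close>), and the model underestimates the objective by at most \<open>L_U / 2 * (norm d)\<^sup>2\<close>
  (\<open>model_error\<close>), so \<open>Act \<ge> Pred + q / 2 - L_U / 2 * (norm d)\<^sup>2\<close>. Hence
  \<open>Act - \<alpha>1 * Pred \<ge> (2 - \<alpha>1) * q / 2 - L_U / 2 * (norm d)\<^sup>2\<close>, which is nonnegative as soon as
  \<open>(2 - \<alpha>1) * \<mu> \<ge> L_U\<close> (\<open>trial_step_accepted\<close>). An accepted step can raise \<open>\<mu>\<close> only by resetting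
  it to \<open>\<mu>_min\<close>; this is why \<open>\<mu>_min\<close> enters the upper bound unless it lies below \<open>\<mu>_bar\<close>.
\<close>

section \<open>Quadratic forms and the projection onto the semidefinite cone\<close>

lemma quadratic_form_mat: "v \<bullet> (mat c *v v) = c * (norm v)\<^sup>2" for v :: "real^'m"
proof -
  have "mat c *v v = c *\<^sub>R v"
    by (vector matrix_vector_mult_def mat_def) (simp add: if_distrib[of "\<lambda>a. a * _"] cong: if_cong)
  then show ?thesis
    by (simp add: power2_norm_eq_inner)
qed

lemma symmetric_quadratic_swap:
  fixes A :: "real^'m^'m"
  assumes "transpose A = A"
  shows "v \<bullet> (A *v w) = w \<bullet> (A *v v)"
  by (metis assms dot_lmul_matrix inner_commute transpose_matrix_vector)

lemma loewner_leI:
  assumes "transpose A = A" "transpose B = B"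
    and "\<And>v. v \<bullet> (A *v v) \<le> v \<bullet> (B *v v)"
  shows "A \<preceq>\<^sub>L B"
proof -
  have "transpose (B - A) = B - A"
    using assms(1,2) by (simp add: transpose_def vec_eq_iff)
  then show ?thesis
    using assms(3) by (simp add: loewner_le_def psd_cone_def matrix_vector_mult_diff_rdistrib inner_diff_right)
qed

lemma mat_le_mat_plus:
  assumes "H \<in> psd_cone" "a \<le> \<mu>"
  shows "mat a \<preceq>\<^sub>L mat \<mu> + H"
proof (rule loewner_leI)
  show "transpose (mat \<mu> + H) = mat \<mu> + H"
    using assms(1) by (auto simp: psd_cone_def transpose_def mat_def vec_eq_iff)
  have "a * (norm v)\<^sup>2 \<le> \<mu> * (norm v)\<^sup>2" for v :: "real^'a"
    using assms(2) by (rule mult_right_mono) simp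
  then show "v \<bullet> (mat a *v v) \<le> v \<bullet> ((mat \<mu> + H) *v v)" for v
    using assms(1)
    by (simp add: psd_cone_def matrix_vector_mult_add_rdistrib inner_add_right quadratic_form_mat
        add_increasing2)
qed (rule transpose_mat)

lemma mat_plus_le_mat:
  assumes "H \<in> psd_cone" "\<And>v. v \<bullet> (H *v v) \<le> c * (norm v)\<^sup>2" "\<mu> + c \<le> b"
  shows "mat \<mu> + H \<preceq>\<^sub>L mat b"
proof (rule loewner_leI)
  show "transpose (mat \<mu> + H) = mat \<mu> + H"
    using assms(1) by (auto simp: psd_cone_def transpose_def mat_def vec_eq_iff)
  fix v
  have "v \<bullet> ((mat \<mu> + H) *v v) \<le> (\<mu> + c) * (norm v)\<^sup>2"
    using assms(2)[of v]
    by (simp add: matrix_vector_mult_add_rdistrib inner_add_right quadratic_form_mat distrib_right)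
  also have "\<dots> \<le> b * (norm v)\<^sup>2"
    using assms(3) by (rule mult_right_mono) simp
  finally show "v \<bullet> ((mat \<mu> + H) *v v) \<le> v \<bullet> (mat b *v v)"
    by (simp add: quadratic_form_mat)
qed (rule transpose_mat)

lemma psd_coneI:
  "transpose A = A \<Longrightarrow> (\<And>v. 0 \<le> v \<bullet> (A *v v)) \<Longrightarrow> A \<in> psd_cone"
  by (simp add: psd_cone_def)

lemma quadratic_form_outer:
  fixes u :: "real^'m"
  shows "w \<bullet> ((\<chi> i j. u $ i * u $ j) *v w) = (u \<bullet> w)\<^sup>2"
proof -
  have "(\<chi> i j. u $ i * u $ j) *v w = (u \<bullet> w) *\<^sub>R u"
    by (vector matrix_vector_mult_def inner_vec_def) (simp add: sum_distrib_left ac_simps)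
  then show ?thesis
    by (simp add: power2_eq_square inner_commute)
qed

lemma inner_outer:
  fixes A :: "real^'m^'m"
  shows "A \<bullet> (\<chi> i j. u $ i * u $ j) = u \<bullet> (A *v u)"
  by (simp add: inner_vec_def matrix_vector_mult_def sum_distrib_left ac_simps)

lemma closed_psd_cone: "closed (psd_cone :: (real^'m^'m) set)"
proof -
  have "continuous_on UNIV (\<lambda>A::real^'m^'m. transpose A)"
    unfolding transpose_def by (intro continuous_intros)
  moreover have "continuous_on UNIV (\<lambda>A::real^'m^'m. v \<bullet> (A *v v))" for v
    unfolding matrix_vector_mult_def by (intro continuous_intros)
  ultimately show ?thesis
    unfolding psd_cone_def
    by (intro closed_Collect_conj closed_Collect_eq closed_Collect_all closed_Collect_le continuous_on_const continuous_on_id)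
qed

lemma zero_in_psd_cone: "0 \<in> psd_cone"
  by (simp add: psd_cone_def transpose_def vec_eq_iff)

lemma psd_proj_in_psd_cone: "psd_proj A \<in> psd_cone"
  unfolding psd_proj_def using closed_psd_cone zero_in_psd_cone
  by (intro closest_point_in_set) auto

lemma psd_cauchy_schwarz:
  fixes P :: "real^'m^'m"
  assumes "P \<in> psd_cone" "0 < v \<bullet> (P *v v)"
  shows "(w \<bullet> (P *v v))\<^sup>2 \<le> (w \<bullet> (P *v w)) * (v \<bullet> (P *v v))"
proof -
  define a b c where "a = w \<bullet> (P *v w)" and "b = w \<bullet> (P *v v)" and "c = v \<bullet> (P *v v)"
  have "c > 0" using assms(2) by (simp add: c_def)
  have sym: "v \<bullet> (P *v w) = b"
    using assms(1) symmetric_quadratic_swap[of P v w] by (simp add: psd_cone_def b_def)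
  \<comment> \<open>The minimizer of the form along the line \<open>w + e *\<^sub>R v\<close>.\<close>
  define e where "e = - b / c"
  have "0 \<le> (w + e *\<^sub>R v) \<bullet> (P *v (w + e *\<^sub>R v))"
    using assms(1) by (simp add: psd_cone_def)
  also have "\<dots> = a + 2 * e * b + e * e * c"
    using sym by (simp add: matrix_vector_right_distrib matrix_vector_mult_scaleR inner_add_left inner_add_right
        a_def b_def c_def algebra_simps)
  also have "\<dots> = a - b\<^sup>2 / c"
    using \<open>c > 0\<close> by (simp add: e_def power2_eq_square field_simps)
  finally show ?thesis
    using \<open>c > 0\<close> by (simp add: field_simps flip: a_def b_def c_def)
qed

text \<open>
  If the projection \<open>P\<close> of \<open>A\<close> exceeded \<open>c\<close> in some direction \<open>v\<close>, then \<open>P\<close> would also exceed \<open>A\<close> in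
  the direction \<open>u = P *v v\<close>, and the rank-one downdate \<open>P - t *\<^sub>R u u\<^sup>T\<close> would lie closer to \<open>A\<close> for
  small \<open>t > 0\<close>. It stays in the cone because of the Cauchy-Schwarz inequality for the form of \<open>P\<close>;
  this is what the direction \<open>u\<close>, rather than \<open>v\<close>, is good for. Only the quadratic form of \<open>A\<close> enters,
  so the bound applies to Hessians without appeal to the symmetry of second derivatives.
\<close>

lemma psd_proj_quadratic_le:
  fixes A :: "real^'m^'m"
  assumes bound: "\<And>v. v \<bullet> (A *v v) \<le> c * (norm v)\<^sup>2" and "0 \<le> c"
  shows "v \<bullet> (psd_proj A *v v) \<le> c * (norm v)\<^sup>2"
proof (rule ccontr)
  define P where "P = psd_proj A"
  define u where "u = P *v v"
  define \<sigma> where "\<sigma> = v \<bullet> (P *v v)"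
  define U :: "real^'m^'m" where "U = (\<chi> i j. u $ i * u $ j)"
  define \<delta> where "\<delta> = (P - A) \<bullet> U"
  assume "\<not> ?thesis"
  then have big: "c * (norm v)\<^sup>2 < \<sigma>"
    by (simp add: \<sigma>_def P_def)
  have P: "P \<in> psd_cone"
    by (simp add: P_def psd_proj_in_psd_cone)
  have "0 \<le> c * (norm v)\<^sup>2" using \<open>0 \<le> c\<close> by simp
  with big have "\<sigma> > 0" by linarith
  have cs: "(w \<bullet> u)\<^sup>2 \<le> (w \<bullet> (P *v w)) * \<sigma>" for w
    using psd_cauchy_schwarz[OF P, of v w] \<open>\<sigma> > 0\<close> by (simp add: u_def \<sigma>_def)
  have uv: "v \<bullet> u = \<sigma>" by (simp add: u_def \<sigma>_def)
  have "u \<noteq> 0" using uv \<open>\<sigma> > 0\<close> by auto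
  \<comment> \<open>One step of the power method does not lower the Rayleigh quotient, so the form of \<open>P\<close>
    exceeds \<open>c\<close> in the direction \<open>u\<close> too.\<close>
  have "\<delta> > 0"
  proof -
    have nv: "0 < norm v" using uv \<open>\<sigma> > 0\<close> by auto
    have 1: "\<sigma>\<^sup>2 \<le> (norm v)\<^sup>2 * (norm u)\<^sup>2"
      using Cauchy_Schwarz_ineq[of v u] uv by (simp add: power2_norm_eq_inner)
    have 2: "(norm u)\<^sup>2 * (norm u)\<^sup>2 \<le> (u \<bullet> (P *v u)) * \<sigma>"
      using cs[of u] unfolding power2_norm_eq_inner by (simp add: power2_eq_square)
    have "(norm u)\<^sup>2 * \<sigma>\<^sup>2 \<le> (norm u)\<^sup>2 * ((norm v)\<^sup>2 * (norm u)\<^sup>2)"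
      using 1 by (intro mult_left_mono) auto
    also have "\<dots> \<le> (norm v)\<^sup>2 * ((u \<bullet> (P *v u)) * \<sigma>)"
      using mult_left_mono[OF 2, of "(norm v)\<^sup>2"] by (simp add: ac_simps)
    finally have 3: "(norm u)\<^sup>2 * \<sigma> \<le> (norm v)\<^sup>2 * (u \<bullet> (P *v u))"
      using \<open>\<sigma> > 0\<close> by (simp add: power2_eq_square mult.assoc[symmetric])
    have "(norm v)\<^sup>2 * (c * (norm u)\<^sup>2) < (norm u)\<^sup>2 * \<sigma>"
      using mult_strict_left_mono[OF big, of "(norm u)\<^sup>2"] \<open>u \<noteq> 0\<close> by (simp add: ac_simps)
    with 3 have "(norm v)\<^sup>2 * (c * (norm u)\<^sup>2) < (norm v)\<^sup>2 * (u \<bullet> (P *v u))"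
      by linarith
    with nv have "c * (norm u)\<^sup>2 < u \<bullet> (P *v u)" by simp
    then show ?thesis
      using bound[of u] by (simp add: \<delta>_def U_def inner_outer matrix_vector_mult_diff_rdistrib inner_diff_right)
  qed
  \<comment> \<open>The first bound on \<open>t\<close> keeps the downdate in the cone; the second makes the linear gain
    \<open>2 * t * \<delta>\<close> in the squared distance exceed the quadratic loss.\<close>
  define t where "t = min (1 / \<sigma>) (\<delta> / ((norm U)\<^sup>2 + 1))"
  have pos: "(norm U)\<^sup>2 + 1 > 0" by (simp add: add_nonneg_pos)
  have "t > 0" using \<open>\<sigma> > 0\<close> \<open>\<delta> > 0\<close> pos by (simp add: t_def)
  have "P - t *\<^sub>R U \<in> psd_cone"
  proof (rule psd_coneI)
    show "transpose (P - t *\<^sub>R U) = P - t *\<^sub>R U"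
      using P by (auto simp: psd_cone_def transpose_def vec_eq_iff U_def)
    fix w
    have "t * (u \<bullet> w)\<^sup>2 \<le> 1 / \<sigma> * ((w \<bullet> (P *v w)) * \<sigma>)"
      using cs[of w] \<open>\<sigma> > 0\<close> \<open>t > 0\<close> by (intro mult_mono) (auto simp: t_def inner_commute)
    then show "0 \<le> w \<bullet> ((P - t *\<^sub>R U) *v w)"
      using \<open>\<sigma> > 0\<close>
      by (simp add: U_def matrix_vector_mult_diff_rdistrib inner_diff_right quadratic_form_outer
          flip: scaleR_matrix_vector_assoc)
  qed
  then have "dist A P \<le> dist A (P - t *\<^sub>R U)"
    unfolding P_def psd_proj_def using closest_point_le[OF closed_psd_cone] by blast
  then have "(norm (P - A))\<^sup>2 \<le> (norm ((P - A) - t *\<^sub>R U))\<^sup>2"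
    by (simp add: dist_norm norm_minus_commute algebra_simps)
  also have "\<dots> = (norm (P - A))\<^sup>2 - 2 * t * \<delta> + t * (t * (norm U)\<^sup>2)"
    unfolding \<delta>_def power2_norm_eq_inner
    by (simp add: inner_diff_left inner_diff_right inner_commute algebra_simps)
  finally have "t * (2 * \<delta>) \<le> t * (t * (norm U)\<^sup>2)" by simp
  with \<open>t > 0\<close> have "2 * \<delta> \<le> t * (norm U)\<^sup>2" by simp
  also have "\<dots> \<le> \<delta> / ((norm U)\<^sup>2 + 1) * ((norm U)\<^sup>2 + 1)"
    using \<open>\<delta> > 0\<close> pos by (intro mult_mono) (auto simp: t_def)
  also have "\<dots> = \<delta>" using pos by simp
  finally show False using \<open>\<delta> > 0\<close> by simp
qed


section \<open>Derivatives, gradients and Hessian forms\<close>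

lemma deriv_op_works:
  assumes "f differentiable (at x)"
  shows "(f has_derivative blinfun_apply (deriv_op f x)) (at x)"
proof -
  have "bounded_linear (frechet_derivative f (at x))"
    using assms by (metis frechet_derivative_works has_derivative_bounded_linear)
  then show ?thesis
    using assms by (simp add: deriv_op_def bounded_linear_Blinfun_apply frechet_derivative_works)
qed

lemma deriv_op_eqI:
  assumes "(f has_derivative f') (at x)"
  shows "blinfun_apply (deriv_op f x) = f'"
  using assms deriv_op_works has_derivative_unique differentiable_def by blast

lemma jacobian_mult_eq_deriv_op:
  fixes f :: "real^'m \<Rightarrow> real^'d"
  assumes "f differentiable (at x)"
  shows "jacobian f (at x) *v v = deriv_op f x v"
  using deriv_op_eqI[of f "\<lambda>v. jacobian f (at x) *v v" x] assms jacobian_works[of f "at x"] by simp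

lemma grad_works:
  fixes f :: "'a::euclidean_space \<Rightarrow> real"
  assumes "f differentiable (at x)"
  shows "GDERIV f x :> grad f x"
proof -
  let ?f' = "blinfun_apply (deriv_op f x)"
  have lin: "linear ?f'"
    by (simp add: blinfun.bounded_linear_right bounded_linear.linear)
  obtain a where "?f' = (\<lambda>v. v \<bullet> a)"
    using adjoint_works[OF lin, of _ 1] by (metis inner_real_def mult.right_neutral)
  then have ex: "GDERIV f x :> a"
    using deriv_op_works[OF assms] by (simp add: gderiv_def)
  have unique: "v = w" if "GDERIV f x :> v" "GDERIV f x :> w" for v w
  proof -
    have "(\<lambda>h. h \<bullet> v) = (\<lambda>h. h \<bullet> w)"
      using that has_derivative_unique unfolding gderiv_def by blast
    then have "\<forall>h. h \<bullet> v = h \<bullet> w" by metis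
    then show ?thesis using vector_eq_ldot by blast
  qed
  with ex show ?thesis
    unfolding grad_def by (rule theI[where a = a]) (use ex unique in auto)
qed

lemma inner_grad:
  fixes f :: "'a::euclidean_space \<Rightarrow> real"
  assumes "f differentiable (at x)"
  shows "grad f x \<bullet> v = deriv_op f x v"
  using deriv_op_eqI[OF grad_works[OF assms, unfolded gderiv_def]] by (simp add: inner_commute)

text \<open>
  On scalar functions the gradient and the operator-valued derivative have the same increments,
  so \<open>s\<close> can be treated by the estimates for vector-valued maps.
\<close>

lemma deriv_op_lipschitz:
  fixes f :: "'a::euclidean_space \<Rightarrow> real"
  assumes f: "\<And>x. f differentiable (at x)" and L: "\<beta>-lipschitz_on UNIV (grad f)"
  shows "\<beta>-lipschitz_on UNIV (deriv_op f)"
proof (rule lipschitz_onI)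
  fix x y
  have "norm (deriv_op f x - deriv_op f y) \<le> norm (grad f x - grad f y)"
  proof (rule norm_blinfun_bound)
    fix v
    have "blinfun_apply (deriv_op f x - deriv_op f y) v = (grad f x - grad f y) \<bullet> v"
      using inner_grad[OF f] by (simp add: blinfun.diff_left inner_diff_left)
    then show "norm (blinfun_apply (deriv_op f x - deriv_op f y) v) \<le> norm (grad f x - grad f y) * norm v"
      by (simp add: Cauchy_Schwarz_ineq2)
  qed simp
  then show "dist (deriv_op f x) (deriv_op f y) \<le> \<beta> * dist x y"
    using lipschitz_onD[OF L, of x y] by (simp add: dist_norm)
qed (rule lipschitz_on_nonneg[OF L])

lemma deriv_op_along_line:
  assumes "f differentiable (at (x + t *\<^sub>R v))"
  shows "((\<lambda>t. f (x + t *\<^sub>R v)) has_vector_derivative deriv_op f (x + t *\<^sub>R v) v) (at t)"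
proof -
  have "((\<lambda>t. f (x + t *\<^sub>R v)) has_derivative (\<lambda>h. deriv_op f (x + t *\<^sub>R v) (h *\<^sub>R v))) (at t)"
    by (rule has_derivative_compose[where f = "\<lambda>t. x + t *\<^sub>R v"])
      (use deriv_op_works[OF assms] in \<open>auto intro!: derivative_eq_intros\<close>)
  then show ?thesis
    by (simp add: has_vector_derivative_def blinfun.scaleR_right)
qed

lemma deriv_op_lipschitz_apply:
  assumes "\<beta>-lipschitz_on UNIV (deriv_op f)" "0 \<le> t"
  shows "norm (deriv_op f (x + t *\<^sub>R v) v - deriv_op f x v) \<le> \<beta> * (norm v)\<^sup>2 * t"
proof -
  have "norm (deriv_op f (x + t *\<^sub>R v) v - deriv_op f x v)
      \<le> norm (deriv_op f (x + t *\<^sub>R v) - deriv_op f x) * norm v"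
    by (metis blinfun.diff_left norm_blinfun)
  also have "\<dots> \<le> (\<beta> * (t * norm v)) * norm v"
    using lipschitz_onD[OF assms(1), of "x + t *\<^sub>R v" x] \<open>0 \<le> t\<close>
    by (intro mult_right_mono) (auto simp: dist_norm)
  finally show ?thesis
    by (simp add: power2_eq_square ac_simps)
qed

text \<open>
  The factor \<open>1/2\<close>, which a plain mean value estimate would lose, comes from comparing the error
  along the segment with the majorant \<open>\<beta> / 2 * (norm v)\<^sup>2 * t\<^sup>2\<close>.
\<close>

lemma linearization_error:
  assumes f: "\<And>x. f differentiable (at x)" and L: "\<beta>-lipschitz_on UNIV (deriv_op f)"
  shows "norm (f (x + v) - f x - deriv_op f x v) \<le> \<beta> / 2 * (norm v)\<^sup>2"
proof -
  let ?\<phi> = "\<lambda>t::real. f (x + t *\<^sub>R v) - t *\<^sub>R deriv_op f x v"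
  let ?b = "\<lambda>t::real. \<beta> / 2 * (norm v)\<^sup>2 * t\<^sup>2"
  have \<phi>: "(?\<phi> has_vector_derivative (deriv_op f (x + t *\<^sub>R v) v - deriv_op f x v)) (at t)" for t
    using deriv_op_along_line[OF f, of x v t] by (auto intro!: derivative_eq_intros)
  have b: "(?b has_vector_derivative \<beta> * (norm v)\<^sup>2 * t) (at t)" for t
    by (auto intro!: derivative_eq_intros simp flip: has_real_derivative_iff_has_vector_derivative)
  have "norm (?\<phi> 1 - ?\<phi> 0) \<le> ?b 1 - ?b 0"
  proof (rule differentiable_bound_general[OF zero_less_one])
    show "continuous_on {0..1} ?\<phi>"
      using \<phi> by (meson continuous_at_imp_continuous_on has_vector_derivative_continuous)
    show "continuous_on {0..1} ?b"
      by (intro continuous_intros)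
  qed (use \<phi> b deriv_op_lipschitz_apply[OF L] in auto)
  then show ?thesis by (simp add: algebra_simps)
qed

lemma grad_above_tangent:
  fixes f :: "'a::euclidean_space \<Rightarrow> real"
  assumes "convex_on UNIV f" and f: "f differentiable (at x)"
  shows "f z \<ge> f x + grad f x \<bullet> (z - x)"
proof -
  let ?\<phi> = "\<lambda>t. f (x + t *\<^sub>R (z - x))"
  have "convex_on UNIV ?\<phi>"
  proof (rule convex_onI)
    fix t a b :: real assume "0 < t" "t < 1"
    have "x + ((1 - t) *\<^sub>R a + t *\<^sub>R b) *\<^sub>R (z - x)
        = (1 - t) *\<^sub>R (x + a *\<^sub>R (z - x)) + t *\<^sub>R (x + b *\<^sub>R (z - x))"
      by (simp add: algebra_simps)
    with convex_onD[OF assms(1), of t] \<open>0 < t\<close> \<open>t < 1\<close>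
    show "?\<phi> ((1 - t) *\<^sub>R a + t *\<^sub>R b) \<le> (1 - t) * ?\<phi> a + t * ?\<phi> b" by simp
  qed simp
  moreover have "(?\<phi> has_real_derivative grad f x \<bullet> (z - x)) (at 0)"
    using deriv_op_along_line[of f x 0 "z - x"] f
    by (simp add: has_real_derivative_iff_has_vector_derivative inner_grad)
  ultimately have "?\<phi> 1 - ?\<phi> 0 \<ge> (grad f x \<bullet> (z - x)) * (1 - 0)"
    by (intro convex_on_imp_above_tangent[of UNIV]) auto
  then show ?thesis by simp
qed

lemma has_real_derivative_le:
  fixes \<phi> :: "real \<Rightarrow> real"
  assumes "(\<phi> has_real_derivative D) (at 0)" and "\<And>t. 0 < t \<Longrightarrow> \<phi> t - \<phi> 0 \<le> K * t"
  shows "D \<le> K"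
proof (rule tendsto_upperbound)
  show "((\<lambda>t. (\<phi> t - \<phi> 0) / t) \<longlongrightarrow> D) (at_right 0)"
    using assms(1) has_field_derivative_at_within[of \<phi> D 0 "{0<..}"]
    by (simp add: has_field_derivative_iff)
  show "\<forall>\<^sub>F t in at_right 0. (\<phi> t - \<phi> 0) / t \<le> K"
    using assms(2) by (auto simp: eventually_at_filter pos_divide_le_eq intro!: always_eventually)
qed simp

text \<open>
  The Hessian form is a derivative along a line. A functional \<open>l\<close> is carried along so that the
  Hessians of the components of a vector-valued map can be controlled jointly by the Lipschitz
  constant of its derivative, instead of one by one.
\<close>

lemma hessian_quadratic_derivative:
  fixes f :: "real^'m \<Rightarrow> 'b::real_normed_vector" and l :: "'b \<Rightarrow> real"
  assumes C2: "C2_on UNIV f" and l: "bounded_linear l"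
  shows "((\<lambda>t. l (deriv_op f (x + t *\<^sub>R v) v))
    has_real_derivative v \<bullet> (hessian (\<lambda>z. l (f z)) x *v v)) (at 0)"
proof -
  let ?F = "\<lambda>z. l (f z)"
  have f: "f differentiable (at z)" and df: "deriv_op f differentiable (at z)" for z
    using C2 by (auto simp: C2_on_def C1_on_def)
  have F: "(?F has_derivative (\<lambda>w. l (deriv_op f z w))) (at z)" for z
    by (rule bounded_linear.has_derivative[OF l deriv_op_works[OF f]])
  have apply_grad: "grad ?F z \<bullet> w = l (deriv_op f z w)" for z w
    using F[of z] inner_grad[of ?F z w] deriv_op_eqI[OF F[of z]] by (auto simp: differentiable_def)
  have "grad ?F = (\<lambda>z. \<Sum>b\<in>Basis. l (deriv_op f z b) *\<^sub>R b)"
    by (simp add: fun_eq_iff euclidean_representation flip: apply_grad)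
  moreover have "(\<lambda>z. \<Sum>b\<in>Basis. l (deriv_op f z b) *\<^sub>R b) differentiable (at x)"
  proof (intro differentiable_sum ballI finite_Basis)
    fix b :: "real^'m"
    have "bounded_linear (\<lambda>T. l (blinfun_apply T b) *\<^sub>R b)"
      by (intro bounded_linear_compose[OF bounded_linear_scaleR_left]
          bounded_linear_compose[OF l blinfun.bounded_linear_left])
    then show "(\<lambda>z. l (deriv_op f z b) *\<^sub>R b) differentiable (at x)"
      using bounded_linear.has_derivative deriv_op_works[OF df[of x]]
      unfolding differentiable_def by blast
  qed
  ultimately have "grad ?F differentiable (at x)" by simp
  then have G: "(grad ?F has_derivative (\<lambda>w. hessian ?F x *v w)) (at x)"
    by (simp add: hessian_def flip: jacobian_works)
  have "((\<lambda>t. grad ?F (x + t *\<^sub>R v)) has_derivative (\<lambda>h. hessian ?F x *v (h *\<^sub>R v))) (at 0)"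
    by (rule has_derivative_compose[where f = "\<lambda>t. x + t *\<^sub>R v"])
      (use G in \<open>auto intro!: derivative_eq_intros\<close>)
  then have "((\<lambda>t. grad ?F (x + t *\<^sub>R v) \<bullet> v) has_derivative (\<lambda>h. (hessian ?F x *v (h *\<^sub>R v)) \<bullet> v)) (at 0)"
    by (rule has_derivative_inner_left)
  then show ?thesis
    unfolding apply_grad
    by (simp add: has_field_derivative_def inner_commute matrix_vector_mult_scaleR mult.commute[of _ "v \<bullet> _"])
qed

lemma subgradient_norm_le:
  assumes L: "L-lipschitz_on UNIV f" and y: "y \<in> subdifferential f x"
  shows "norm y \<le> L"
proof (cases "y = 0")
  case True
  then show ?thesis using lipschitz_on_nonneg[OF L] by simp
next
  case False
  have "norm y * norm y \<le> f (x + y) - f x"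
    using y by (auto simp: subdifferential_def power2_norm_eq_inner power2_eq_square dest!: spec[of _ "x + y"]
        simp flip: power2_norm_eq_inner)
  also have "\<dots> \<le> L * norm y"
    using lipschitz_onD[OF L, of "x + y" x] by (simp add: dist_norm)
  finally show ?thesis using False by simp
qed


section \<open>The cap on the curvature block\<close>

lemma norm_le_L2_set:
  fixes w :: "real^'n"
  assumes "\<And>i. \<bar>w $ i\<bar> \<le> L i * a"
  shows "(norm w)\<^sup>2 \<le> (L2_set L UNIV)\<^sup>2 * a\<^sup>2"
proof -
  have "(norm w)\<^sup>2 = (\<Sum>i\<in>UNIV. \<bar>w $ i\<bar>\<^sup>2)"
    by (simp add: norm_vec_def L2_set_def sum_nonneg)
  also have "\<dots> \<le> (\<Sum>i\<in>UNIV. (L i * a)\<^sup>2)"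
    using assms by (intro sum_mono power_mono) auto
  also have "\<dots> = (L2_set L UNIV)\<^sup>2 * a\<^sup>2"
    by (simp add: L2_set_def sum_nonneg power_mult_distrib sum_distrib_right)
  finally show ?thesis .
qed

lemma quadratic_form_sum:
  fixes A :: "'i \<Rightarrow> real^'m^'m"
  shows "v \<bullet> ((\<Sum>i\<in>I. c i *\<^sub>R A i) *v v) = (\<Sum>i\<in>I. c i * (v \<bullet> (A i *v v)))"
  by (induction I rule: infinite_finite_induct)
    (simp_all add: matrix_vector_mult_add_rdistrib inner_add_right flip: scaleR_matrix_vector_assoc)

text \<open>
  Bounding each component Hessian separately would cost a factor depending on the dimension. The
  weighted sum of their forms is the derivative of \<open>y \<bullet> deriv_op C (x + t *\<^sub>R v) v\<close>, to which
  Cauchy-Schwarz applies once.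
\<close>

lemma weighted_hessian_form_le:
  fixes C :: "real^'m \<Rightarrow> real^'d"
  assumes C: "C2_on UNIV C" and lip: "\<beta>-lipschitz_on UNIV (deriv_op C)" and y: "norm y \<le> L"
  shows "v \<bullet> ((\<Sum>j\<in>UNIV. (y $ j) *\<^sub>R hessian (\<lambda>z. C z $ j) x) *v v) \<le> L * \<beta> * (norm v)\<^sup>2"
proof (rule has_real_derivative_le)
  let ?\<phi> = "\<lambda>t. \<Sum>j\<in>UNIV. y $ j * (deriv_op C (x + t *\<^sub>R v) v $ j)"
  show "(?\<phi> has_real_derivative v \<bullet> ((\<Sum>j\<in>UNIV. (y $ j) *\<^sub>R hessian (\<lambda>z. C z $ j) x) *v v)) (at 0)"
    unfolding quadratic_form_sum
    by (intro DERIV_sum DERIV_cmult hessian_quadratic_derivative[OF C bounded_linear_vec_nth])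
  fix t :: real assume "0 < t"
  have "?\<phi> t - ?\<phi> 0 = y \<bullet> (deriv_op C (x + t *\<^sub>R v) v - deriv_op C x v)"
    by (simp add: inner_vec_def sum_subtractf algebra_simps)
  also have "\<dots> \<le> norm y * norm (deriv_op C (x + t *\<^sub>R v) v - deriv_op C x v)"
    by (rule norm_cauchy_schwarz)
  also have "\<dots> \<le> L * (\<beta> * (norm v)\<^sup>2 * t)"
    using y \<open>0 < t\<close> norm_ge_zero[of y]
    by (intro mult_mono deriv_op_lipschitz_apply[OF lip]) (linarith | simp)+
  finally show "?\<phi> t - ?\<phi> 0 \<le> L * \<beta> * (norm v)\<^sup>2 * t"
    by (simp add: ac_simps)
qed

lemma hessian_form_le:
  fixes f :: "real^'m \<Rightarrow> real"
  assumes f: "C2_on UNIV f" and lip: "\<beta>-lipschitz_on UNIV (deriv_op f)"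
  shows "v \<bullet> (hessian f x *v v) \<le> \<beta> * (norm v)\<^sup>2"
proof (rule has_real_derivative_le)
  show "((\<lambda>t. deriv_op f (x + t *\<^sub>R v) v) has_real_derivative v \<bullet> (hessian f x *v v)) (at 0)"
    using hessian_quadratic_derivative[OF f bounded_linear_ident] .
  fix t :: real assume "0 < t"
  then show "deriv_op f (x + t *\<^sub>R v) v - deriv_op f (x + 0 *\<^sub>R v) v \<le> \<beta> * (norm v)\<^sup>2 * t"
    using deriv_op_lipschitz_apply[OF lip, of t x v] by simp
qed

lemma hessian_form_nonneg:
  fixes f :: "real^'m \<Rightarrow> real"
  assumes f: "C2_on UNIV f" and conv: "convex_on UNIV f"
  shows "0 \<le> v \<bullet> (hessian f x *v v)"
proof -
  have diff: "f differentiable (at z)" for z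
    using f by (auto simp: C2_on_def C1_on_def)
  have "- (v \<bullet> (hessian f x *v v)) \<le> 0"
  proof (rule has_real_derivative_le)
    show "((\<lambda>t. - deriv_op f (x + t *\<^sub>R v) v) has_real_derivative - (v \<bullet> (hessian f x *v v))) (at 0)"
      using hessian_quadratic_derivative[OF f bounded_linear_ident] by (rule DERIV_minus)
    fix t :: real assume "0 < t"
    have "f (x + t *\<^sub>R v) \<ge> f x + t * deriv_op f x v"
      using grad_above_tangent[OF conv diff, of x "x + t *\<^sub>R v"]
      by (simp add: inner_grad[OF diff])
    moreover have "f x \<ge> f (x + t *\<^sub>R v) - t * deriv_op f (x + t *\<^sub>R v) v"
      using grad_above_tangent[OF conv diff, of "x + t *\<^sub>R v" x]
      by (simp add: inner_grad[OF diff])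
    ultimately have "t * deriv_op f x v \<le> t * deriv_op f (x + t *\<^sub>R v) v" by linarith
    with \<open>0 < t\<close>
    show "- deriv_op f (x + t *\<^sub>R v) v - - deriv_op f (x + 0 *\<^sub>R v) v \<le> 0 * t" by simp
  qed
  then show ?thesis by simp
qed

lemma curvature_block_bound:
  fixes C :: "real^'m \<Rightarrow> real^'d" and s :: "real^'n \<Rightarrow> real"
  assumes s: "C1_on UNIV s"
    and r: "\<And>i. convex_on UNIV (r i)"
    and h_lip: "L_h-lipschitz_on UNIV h"
    and C_lip: "\<beta>_C-lipschitz_on UNIV (deriv_op C)"
    and s_lip: "\<beta>_s-lipschitz_on UNIV (grad s)"
    and r_lip: "\<And>i. (L_r i)-lipschitz_on UNIV (r i)"
    and H: "H \<in> curvature_blocks tC ts Tr h C s r x"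
  shows "H \<in> psd_cone"
    and "v \<bullet> (H *v v) \<le> (\<beta>_C * L_h + \<beta>_s * (L2_set L_r UNIV)\<^sup>2) * (norm v)\<^sup>2"
proof -
  let ?L_R = "L2_set L_r UNIV"
  note nonneg = lipschitz_on_nonneg[OF h_lip] lipschitz_on_nonneg[OF C_lip] lipschitz_on_nonneg[OF s_lip]
  obtain HC Hs where H_eq: "H = psd_proj (HC + Hs)"
    and HC: "HC \<in> C_blocks tC h C x" and Hs: "Hs \<in> s_blocks ts Tr s r x"
    using H by (auto simp: curvature_blocks_def)
  show "H \<in> psd_cone" by (simp add: H_eq psd_proj_in_psd_cone)
  have HC_le: "v \<bullet> (HC *v v) \<le> \<beta>_C * L_h * (norm v)\<^sup>2" for v
  proof (cases "C2_on UNIV C \<and> tC")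
    case True
    then obtain y where "y \<in> subdifferential h (C x)"
      and "HC = (\<Sum>j\<in>UNIV. (y $ j) *\<^sub>R hessian (\<lambda>z. C z $ j) x)"
      using HC by (auto simp: C_blocks_def)
    then show ?thesis
      using weighted_hessian_form_le[OF conjunct1[OF True] C_lip subgradient_norm_le[OF h_lip]]
      by (simp add: mult.commute[of \<beta>_C])
  qed (use HC nonneg in \<open>auto simp: C_blocks_def\<close>)
  have Hs_le: "v \<bullet> (Hs *v v) \<le> \<beta>_s * ?L_R\<^sup>2 * (norm v)\<^sup>2" for v
  proof (cases "C2_on UNIV s \<and> ts")
    case True
    define I where "I = {i \<in> Tr. grad s (inner_map r x) $ i < 0 \<and> C2_on UNIV (r i)}"
    obtain G :: "real^'m^'n" where G: "\<And>i. row i G \<in> subdifferential (r i) x"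
      and Hs_eq: "Hs = transpose G ** hessian s (inner_map r x) ** G
        + (\<Sum>i\<in>I. (grad s (inner_map r x) $ i) *\<^sub>R hessian (r i) x)"
      using Hs True by (auto simp: s_blocks_def I_def)
    have "v \<bullet> ((transpose G ** hessian s (inner_map r x) ** G) *v v)
        = (G *v v) \<bullet> (hessian s (inner_map r x) *v (G *v v))"
      by (metis dot_lmul_matrix inner_commute matrix_vector_mul_assoc transpose_matrix_vector)
    also have "\<dots> \<le> \<beta>_s * (norm (G *v v))\<^sup>2"
      using hessian_form_le[OF conjunct1[OF True] deriv_op_lipschitz[OF _ s_lip]] s
      by (simp add: C1_on_def)
    also have "\<dots> \<le> \<beta>_s * (?L_R\<^sup>2 * (norm v)\<^sup>2)"
    proof (intro mult_left_mono norm_le_L2_set)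
      fix i
      have "\<bar>(G *v v) $ i\<bar> \<le> norm (row i G) * norm v"
        using Cauchy_Schwarz_ineq2[of "row i G" v] by (simp add: matrix_vector_mul_component row_def)
      also have "\<dots> \<le> L_r i * norm v"
        using subgradient_norm_le[OF r_lip G] by (intro mult_right_mono) auto
      finally show "\<bar>(G *v v) $ i\<bar> \<le> L_r i * norm v" .
    qed (use nonneg in auto)
    finally have 1: "v \<bullet> ((transpose G ** hessian s (inner_map r x) ** G) *v v)
        \<le> \<beta>_s * ?L_R\<^sup>2 * (norm v)\<^sup>2" by (simp add: ac_simps)
    have 2: "v \<bullet> ((\<Sum>i\<in>I. (grad s (inner_map r x) $ i) *\<^sub>R hessian (r i) x) *v v) \<le> 0"
      unfolding quadratic_form_sum using hessian_form_nonneg[OF _ r]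
      by (intro sum_nonpos mult_nonpos_nonneg) (auto simp: I_def)
    from 1 2 show ?thesis
      unfolding Hs_eq matrix_vector_mult_add_rdistrib inner_add_right by linarith
  qed (use Hs nonneg in \<open>auto simp: s_blocks_def\<close>)
  show "v \<bullet> (H *v v) \<le> (\<beta>_C * L_h + \<beta>_s * ?L_R\<^sup>2) * (norm v)\<^sup>2"
    unfolding H_eq
  proof (rule psd_proj_quadratic_le)
    show "w \<bullet> ((HC + Hs) *v w) \<le> (\<beta>_C * L_h + \<beta>_s * ?L_R\<^sup>2) * (norm w)\<^sup>2" for w
      using HC_le[of w] Hs_le[of w]
      by (simp add: matrix_vector_mult_add_rdistrib inner_add_right distrib_right)
  qed (use nonneg in simp)
qed


section \<open>The prox-convex model and the acceptance test\<close>

text \<open>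
  The model without \<open>g\<close>: \<open>g\<close> is kept exactly and is the only part that may be infinite, so every
  estimate on the model takes place here, in the reals.
\<close>

definition finite_model ::
  "(real^'d \<Rightarrow> real) \<Rightarrow> (real^'m \<Rightarrow> real^'d) \<Rightarrow> (real^'n \<Rightarrow> real) \<Rightarrow>
   ('n \<Rightarrow> real^'m \<Rightarrow> real) \<Rightarrow> real^'m \<Rightarrow> real^'m \<Rightarrow> real" where
  "finite_model h C s r x z =
     h (C x + jacobian C (at x) *v (z - x)) + s (inner_map r x)
       + (\<Sum>i\<in>UNIV. grad s (inner_map r x) $ i * partial_lin s r x i z)"

lemma finite_model_at_centre: "finite_model h C s r x x = h (C x) + s (inner_map r x)"
proof -
  have "partial_lin s r x i x = 0" for i by (simp add: partial_lin_def)
  then show ?thesis by (simp add: finite_model_def)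
qed

lemma finite_model_convex:
  fixes C :: "real^'m \<Rightarrow> real^'d"
  assumes h: "convex_on UNIV h" and r: "\<And>i. convex_on UNIV (r i)"
  shows "convex_on UNIV (finite_model h C s r x)"
proof (rule convex_onI)
  fix t :: real and a b :: "real^'m" assume t: "0 < t" "t < 1"
  define z where "z = (1 - t) *\<^sub>R a + t *\<^sub>R b"
  have z: "z - x = (1 - t) *\<^sub>R (a - x) + t *\<^sub>R (b - x)"
    by (simp add: z_def algebra_simps)
  have "C x + jacobian C (at x) *v (z - x)
      = (1 - t) *\<^sub>R (C x + jacobian C (at x) *v (a - x)) + t *\<^sub>R (C x + jacobian C (at x) *v (b - x))"
    unfolding z by (simp add: matrix_vector_right_distrib matrix_vector_mult_scaleR algebra_simps)
  then have 1: "h (C x + jacobian C (at x) *v (z - x))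
      \<le> (1 - t) * h (C x + jacobian C (at x) *v (a - x)) + t * h (C x + jacobian C (at x) *v (b - x))"
    using convex_onD[OF h, of t] t by simp
  have 2: "grad s (inner_map r x) $ i * partial_lin s r x i z
      \<le> (1 - t) * (grad s (inner_map r x) $ i * partial_lin s r x i a)
        + t * (grad s (inner_map r x) $ i * partial_lin s r x i b)" for i
  proof (cases "grad s (inner_map r x) $ i \<ge> 0")
    case True
    have "r i z - r i x \<le> (1 - t) * (r i a - r i x) + t * (r i b - r i x)"
      using convex_onD[OF r, of t a b i] t by (simp add: z_def algebra_simps)
    from mult_left_mono[OF this True] True show ?thesis
      by (simp add: partial_lin_def algebra_simps)
  qed (simp add: partial_lin_def z inner_add_right algebra_simps)
  have "(\<Sum>i\<in>UNIV. grad s (inner_map r x) $ i * partial_lin s r x i z)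
      \<le> (1 - t) * (\<Sum>i\<in>UNIV. grad s (inner_map r x) $ i * partial_lin s r x i a)
        + t * (\<Sum>i\<in>UNIV. grad s (inner_map r x) $ i * partial_lin s r x i b)"
    unfolding sum_distrib_left sum.distrib[symmetric] by (rule sum_mono) (rule 2)
  with 1 show "finite_model h C s r x ((1 - t) *\<^sub>R a + t *\<^sub>R b)
      \<le> (1 - t) * finite_model h C s r x a + t * finite_model h C s r x b"
    unfolding finite_model_def z_def[symmetric] by (simp add: algebra_simps)
qed simp

text \<open>
  Three errors add up: linearizing \<open>C\<close> inside \<open>h\<close>, linearizing \<open>s\<close> around \<open>inner_map r x\<close>, and
  linearizing those \<open>r i\<close> whose weight is negative. The last one has a favourable sign, since a
  convex function lies above its tangent and the weight reverses the inequality.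
\<close>

lemma model_error:
  fixes C :: "real^'m \<Rightarrow> real^'d" and s :: "real^'n \<Rightarrow> real"
  assumes C: "C1_on UNIV C" and s: "C1_on UNIV s"
    and r: "\<And>i. convex_on UNIV (r i)"
    and h_lip: "L_h-lipschitz_on UNIV h"
    and C_lip: "\<beta>_C-lipschitz_on UNIV (deriv_op C)"
    and s_lip: "\<beta>_s-lipschitz_on UNIV (grad s)"
    and r_lip: "\<And>i. (L_r i)-lipschitz_on UNIV (r i)"
    and linearized: "\<And>i. grad s (inner_map r x) $ i < 0 \<Longrightarrow> r i differentiable (at x)"
  shows "h (C z) + s (inner_map r z)
    \<le> finite_model h C s r x z + (L_h * \<beta>_C + (L2_set L_r UNIV)\<^sup>2 * \<beta>_s) / 2 * (norm (z - x))\<^sup>2"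
proof -
  have dC: "C differentiable (at y)" for y using C by (simp add: C1_on_def)
  have ds: "s differentiable (at y)" for y using s by (simp add: C1_on_def)
  let ?J = "jacobian C (at x) *v (z - x)" and ?R = "inner_map r"
  have "h (C z) - h (C x + ?J) \<le> L_h * norm (C z - C x - ?J)"
    using lipschitz_onD[OF h_lip, of "C z" "C x + ?J"] by (simp add: dist_norm algebra_simps)
  also have "\<dots> \<le> L_h * (\<beta>_C / 2 * (norm (z - x))\<^sup>2)"
    using linearization_error[OF dC C_lip, of x "z - x"] lipschitz_on_nonneg[OF h_lip]
    by (intro mult_left_mono) (auto simp: jacobian_mult_eq_deriv_op[OF dC])
  finally have 1: "h (C z) \<le> h (C x + ?J) + L_h * \<beta>_C / 2 * (norm (z - x))\<^sup>2"
    by simp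
  have "s (?R z) - s (?R x) - grad s (?R x) \<bullet> (?R z - ?R x) \<le> \<beta>_s / 2 * (norm (?R z - ?R x))\<^sup>2"
    using linearization_error[OF ds deriv_op_lipschitz[OF ds s_lip], of "?R x" "?R z - ?R x"]
    unfolding inner_grad[OF ds] real_norm_def add_diff_eq add_diff_cancel_left' by linarith
  also have "\<dots> \<le> \<beta>_s / 2 * ((L2_set L_r UNIV)\<^sup>2 * (norm (z - x))\<^sup>2)"
  proof (intro mult_left_mono norm_le_L2_set)
    show "\<bar>(?R z - ?R x) $ i\<bar> \<le> L_r i * norm (z - x)" for i
      using lipschitz_onD[OF r_lip[of i], of z x] by (simp add: inner_map_def dist_norm)
  qed (use lipschitz_on_nonneg[OF s_lip] in simp)
  finally have 2: "s (?R z) \<le> s (?R x) + grad s (?R x) \<bullet> (?R z - ?R x)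
      + (L2_set L_r UNIV)\<^sup>2 * \<beta>_s / 2 * (norm (z - x))\<^sup>2"
    by (simp add: ac_simps)
  have "grad s (?R x) $ i * (r i z - r i x) \<le> grad s (?R x) $ i * partial_lin s r x i z" for i
    using grad_above_tangent[OF r linearized, of i z]
    by (auto simp: partial_lin_def intro!: mult_left_mono_neg)
  then have 3: "grad s (?R x) \<bullet> (?R z - ?R x)
      \<le> (\<Sum>i\<in>UNIV. grad s (?R x) $ i * partial_lin s r x i z)"
    unfolding inner_vec_def by (auto simp: inner_map_def intro!: sum_mono)
  from 1 2 3 show ?thesis
    by (simp add: finite_model_def distrib_right add_divide_distrib)
qed

lemma ereal_convexD:
  assumes conv: "convex (ereal_epigraph g)"
    and "g a \<le> ereal p" "g b \<le> ereal q" "0 \<le> t" "t \<le> 1"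
  shows "g ((1 - t) *\<^sub>R a + t *\<^sub>R b) \<le> ereal ((1 - t) * p + t * q)"
proof -
  have "(1 - t) *\<^sub>R (a, p) + t *\<^sub>R (b, q) \<in> ereal_epigraph g"
    using assms by (intro convexD[OF conv]) (auto simp: ereal_epigraph_def)
  then show ?thesis by (simp add: ereal_epigraph_def)
qed

text \<open>
  Comparing with \<open>x\<close> itself would only give the decrease \<open>(xp - x) \<bullet> (Q *v (xp - x)) / 2\<close> of the
  unregularized model. Comparing with points of the segment from \<open>xp\<close> to \<open>x\<close>, close to \<open>xp\<close>, gives
  twice as much.
\<close>

lemma prox_step_decrease:
  fixes g :: "real^'m \<Rightarrow> ereal"
  assumes proper: "\<And>z. g z \<noteq> -\<infinity>" and g: "convex (ereal_epigraph g)"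
    and \<phi>: "convex_on UNIV \<phi>"
    and Q: "\<And>v. 0 \<le> v \<bullet> (Q *v v)"
    and xp: "is_arg_min (\<lambda>z. g z + ereal (\<phi> z) + ereal (1/2 * ((z - x) \<bullet> (Q *v (z - x))))) (\<lambda>_. True) xp"
    and gx: "g x = ereal p"
  obtains p' where "g xp = ereal p'"
    and "p' + \<phi> xp + (xp - x) \<bullet> (Q *v (xp - x)) \<le> p + \<phi> x"
proof -
  let ?q = "(xp - x) \<bullet> (Q *v (xp - x))"
  let ?f = "\<lambda>z. g z + ereal (\<phi> z) + ereal (1/2 * ((z - x) \<bullet> (Q *v (z - x))))"
  have min: "?f xp \<le> ?f z" for z
    using xp by (auto simp: is_arg_min_def not_less)
  have "?f x = ereal (p + \<phi> x)" by (simp add: gx)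
  with min[of x] have "g xp \<noteq> \<infinity>" by auto
  with proper[of xp] obtain p' where p': "g xp = ereal p'"
    by (cases "g xp") auto
  have "?q * (1 - t / 2) \<le> (p + \<phi> x) - (p' + \<phi> xp)" if t: "0 < t" "t < 1" for t
  proof -
    let ?z = "(1 - t) *\<^sub>R xp + t *\<^sub>R x"
    have "?z - x = (1 - t) *\<^sub>R (xp - x)" by (simp add: algebra_simps)
    then have q: "(?z - x) \<bullet> (Q *v (?z - x)) = (1 - t)\<^sup>2 * ?q"
      by (simp add: matrix_vector_mult_scaleR power2_eq_square)
    have gz: "g ?z \<le> ereal ((1 - t) * p' + t * p)"
      using t by (intro ereal_convexD[OF g]) (auto simp: p' gx)
    have "ereal (p' + \<phi> xp + 1/2 * ?q) \<le> ?f ?z"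
      using min[of ?z] by (simp add: p')
    also have "\<dots> \<le> ereal ((1 - t) * p' + t * p) + ereal (\<phi> ?z) + ereal (1/2 * ((1 - t)\<^sup>2 * ?q))"
      unfolding q by (intro add_mono gz order_refl)
    finally have "p' + \<phi> xp + 1/2 * ?q \<le> (1 - t) * p' + t * p + \<phi> ?z + 1/2 * ((1 - t)\<^sup>2 * ?q)"
      by simp
    moreover have "\<phi> ?z \<le> (1 - t) * \<phi> xp + t * \<phi> x"
      using convex_onD[OF \<phi>, of t xp x] t by simp
    ultimately have "t * (?q * (1 - t / 2)) \<le> t * ((p + \<phi> x) - (p' + \<phi> xp))"
      by (simp add: power2_eq_square algebra_simps)
    with t show ?thesis by simp
  qed
  then have "\<forall>\<^sub>F t in at_right 0. ?q * (1 - t / 2) \<le> (p + \<phi> x) - (p' + \<phi> xp)"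
    by (intro eventually_at_rightI[of 0 1]) auto
  moreover have "((\<lambda>t. ?q * (1 - t / 2)) \<longlongrightarrow> ?q * (1 - 0 / 2)) (at_right 0)"
    by (intro tendsto_intros) auto
  ultimately have "?q * (1 - 0 / 2) \<le> (p + \<phi> x) - (p' + \<phi> xp)"
    by (intro tendsto_upperbound) auto
  then show thesis using p' by (intro that) auto
qed

text \<open>
  The predicted decrease is at least half the squared \<open>Q\<close>-norm of the step, and dropping the
  proximal term from the prediction gains another half. For large \<open>\<mu>\<close> these two halves absorb the
  model error, even after the fraction \<open>\<alpha>\<close> of the prediction is given up.
\<close>

lemma trial_step_accepted:
  fixes g :: "real^'m \<Rightarrow> ereal"
  assumes g: "proper_closed_convex g" and h: "convex_on UNIV h" and r: "\<And>i. convex_on UNIV (r i)"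
    and Q: "\<And>v. \<mu> * (norm v)\<^sup>2 \<le> v \<bullet> (Q *v v)" and "0 \<le> \<mu>"
    and error: "\<And>z. h (C z) + s (inner_map r z) \<le> finite_model h C s r x z + L / 2 * (norm (z - x))\<^sup>2"
    and x: "x \<in> edom (objective g h C s r)"
    and step: "trial_step g h C s r eps_term Q x xp \<rho>"
    and \<alpha>: "\<alpha> \<le> 1"
  shows "xp \<in> edom (objective g h C s r)"
    and "L \<le> (2 - \<alpha>) * \<mu> \<Longrightarrow> ereal \<alpha> \<le> \<rho>"
proof -
  let ?m = "finite_model h C s r x" and ?f = "\<lambda>z. h (C z) + s (inner_map r z)"
  let ?q = "(xp - x) \<bullet> (Q *v (xp - x))"
  have prox: "prox_model g h C s r Q x
      = (\<lambda>z. g z + ereal (?m z) + ereal (1/2 * ((z - x) \<bullet> (Q *v (z - x)))))"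
    by (simp add: fun_eq_iff prox_model_def model_def finite_model_def)
  have Q0: "0 \<le> v \<bullet> (Q *v v)" for v
    using Q[of v] \<open>0 \<le> \<mu>\<close> by (meson mult_nonneg_nonneg order_trans zero_le_power2)
  have proper: "g z \<noteq> -\<infinity>" for z
    using g by (simp add: proper_closed_convex_def proper_fun_def)
  have "g x \<noteq> \<infinity>"
    using x by (auto simp: edom_def objective_def)
  with proper[of x] obtain p where p: "g x = ereal p"
    by (cases "g x") auto
  obtain p' where p': "g xp = ereal p'" and decrease: "p' + ?m xp + ?q \<le> p + ?m x"
  proof (rule prox_step_decrease[OF proper])
    show "convex (ereal_epigraph g)" using g by (simp add: proper_closed_convex_def)
    show "convex_on UNIV ?m" by (rule finite_model_convex[OF h r])
    show "is_arg_min (\<lambda>z. g z + ereal (?m z) + ereal (1/2 * ((z - x) \<bullet> (Q *v (z - x))))) (\<lambda>_. True) xp"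
      using step unfolding trial_step_def prox by simp
  qed (use p Q0 in auto)
  show "xp \<in> edom (objective g h C s r)"
    by (simp add: edom_def objective_def p')
  define P A where "P = p + ?f x - (p' + ?m xp + 1/2 * ?q)" and "A = p + ?f x - (p' + ?f xp)"
  have Pred: "Pred g h C s r Q x xp = ereal P"
    by (simp add: Pred_def prox objective_def p p' P_def)
  have Act: "Act g h C s r x xp = ereal A"
    by (simp add: Act_def objective_def p p' A_def)
  have P_ge: "1/2 * ?q \<le> P"
    using decrease by (simp add: P_def finite_model_at_centre)
  have "P \<noteq> 0"
    using step by (simp add: trial_step_def Pred)
  with P_ge Q0[of "xp - x"] have "P > 0" by linarith
  have \<rho>: "\<rho> = ereal (A / P)"
    using step \<open>P \<noteq> 0\<close> by (simp add: trial_step_def Pred Act)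
  assume L: "L \<le> (2 - \<alpha>) * \<mu>"
  have "L / 2 * (norm (xp - x))\<^sup>2 \<le> (2 - \<alpha>) / 2 * (\<mu> * (norm (xp - x))\<^sup>2)"
    using mult_right_mono[OF L, of "(norm (xp - x))\<^sup>2"] by (simp add: algebra_simps)
  also have "\<dots> \<le> (2 - \<alpha>) / 2 * ?q"
    using \<alpha> Q by (intro mult_left_mono) auto
  also have "\<dots> = 1/2 * ?q + (1 - \<alpha>) * (1/2 * ?q)"
    by (simp only: left_diff_distrib diff_divide_distrib)
  also have "\<dots> \<le> 1/2 * ?q + (1 - \<alpha>) * P"
    using \<alpha> P_ge by (intro add_left_mono mult_left_mono) auto
  finally have "\<alpha> * P \<le> P + 1/2 * ?q - L / 2 * (norm (xp - x))\<^sup>2"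
    by (simp add: algebra_simps)
  also have "\<dots> \<le> A"
    using error[of xp] by (simp add: P_def A_def)
  finally show "ereal \<alpha> \<le> \<rho>"
    using \<open>P > 0\<close> by (simp add: \<rho> pos_le_divide_eq)
qed


section \<open>Bounds along every run of the algorithm\<close>

theorem lemma3p4:
  fixes g :: "real^'m \<Rightarrow> ereal"
    and h :: "real^'d \<Rightarrow> real"
    and C :: "real^'m \<Rightarrow> real^'d"
    and s :: "real^'n \<Rightarrow> real"
    and r :: "'n \<Rightarrow> real^'m \<Rightarrow> real"
    and x0 :: "real^'m"
    and L_h \<beta>_C \<beta>_s L_s :: real
    and L_r \<beta>_r :: "'n \<Rightarrow> real"
    and tC ts :: bool and Tr :: "'n set"
    and \<mu>0 \<mu>_min \<alpha>1 \<alpha>2 \<nu>_inc \<nu>_dec eps_term :: real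
  assumes g: "proper_closed_convex g"
    and h: "finite_closed_convex h"
    and C: "C1_on UNIV C"
    and s: "C1_on UNIV s"
    and r: "\<And>i. finite_closed_convex (r i)"
    and monotone_or_smooth: "monotone_or_smooth (objective g h C s r) s r"
    and x0: "x0 \<in> edom (objective g h C s r)"
    and level_nonempty: "level_set (objective g h C s r) x0 \<noteq> {}"
    and level_compact: "compact (level_set (objective g h C s r) x0)"
    and h_lipschitz: "L_h-lipschitz_on UNIV h"
    and C_lipschitz: "\<beta>_C-lipschitz_on UNIV (deriv_op C)"
    and s_lipschitz: "\<beta>_s-lipschitz_on UNIV (grad s)"
    and r_lipschitz: "\<And>i. (L_r i)-lipschitz_on UNIV (r i)"
    and grad_s_bound:
      "neg_indices (level_set (objective g h C s r) x0) s r \<noteq> {} \<Longrightarrow>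
         \<forall>y \<in> inner_map r ` {x. objective g h C s r x \<le> objective g h C s r x0}.
           norm (grad s y) \<le> L_s"
    and r_smooth:
      "\<And>i. i \<in> neg_indices (level_set (objective g h C s r) x0) s r \<Longrightarrow>
         C1_on UNIV (r i) \<and> (\<beta>_r i)-lipschitz_on UNIV (grad (r i))"
    and \<mu>0: "\<mu>0 > 0" and \<mu>_min: "\<mu>_min > 0"
    and \<alpha>: "0 < \<alpha>1" "\<alpha>1 < \<alpha>2" "\<alpha>2 < 1"
    and \<nu>_inc: "\<nu>_inc > 1" and \<nu>_dec: "0 < \<nu>_dec" "\<nu>_dec < 1"
  shows
    "let L_R = L2_set L_r UNIV;
         \<beta>_R = L2_set \<beta>_r (neg_indices (level_set (objective g h C s r) x0) s r);
         L_U = L_h * \<beta>_C + L_R\<^sup>2 * \<beta>_s;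
         h_bar = \<beta>_C * L_h + \<beta>_s * L_R\<^sup>2 + L_s * \<beta>_R;
         \<mu>_bar = max \<mu>0 (\<nu>_inc * L_U / (2 - \<alpha>1));
         q_lo = min \<mu>0 \<mu>_min;
         q_hi = \<mu>_bar + h_bar
     in 0 < q_lo \<and> q_lo \<le> q_hi \<and>
        (\<forall>k x \<mu> H Q.
           pc_trial g h C s r tC ts Tr x0 \<mu>0 \<mu>_min \<alpha>1 \<alpha>2 \<nu>_inc \<nu>_dec eps_term k x \<mu> H Q \<longrightarrow>
             mat q_lo \<preceq>\<^sub>L Q \<and>
             (\<mu>_min \<le> \<mu>_bar \<longrightarrow> Q \<preceq>\<^sub>L mat q_hi) \<and>
             Q \<preceq>\<^sub>L mat (max \<mu>_min \<mu>_bar + h_bar))"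
proof -
  let ?F = "objective g h C s r"
  let ?N = "neg_indices (level_set ?F x0) s r"
  let ?L_R = "L2_set L_r UNIV"
  let ?L_U = "L_h * \<beta>_C + ?L_R\<^sup>2 * \<beta>_s"
  let ?cap = "\<beta>_C * L_h + \<beta>_s * ?L_R\<^sup>2"
  let ?h_bar = "?cap + L_s * L2_set \<beta>_r ?N"
  let ?\<mu>_bar = "max \<mu>0 (\<nu>_inc * ?L_U / (2 - \<alpha>1))"
  let ?q_lo = "min \<mu>0 \<mu>_min"
  have h_conv: "convex_on UNIV h" and r_conv: "convex_on UNIV (r i)" for i
    using h r by (simp_all add: finite_closed_convex_def)
  have cap_nonneg: "0 \<le> ?cap"
    using lipschitz_on_nonneg[OF h_lipschitz] lipschitz_on_nonneg[OF C_lipschitz]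
      lipschitz_on_nonneg[OF s_lipschitz] by simp
  \<comment> \<open>If some component is ever linearized, \<open>L_s\<close> bounds the norm of a gradient; otherwise the second
    factor is an empty sum.\<close>
  have "0 \<le> L_s * L2_set \<beta>_r ?N"
  proof (cases "?N = {}")
    case False
    then obtain x where "x \<in> level_set ?F x0"
      by (auto simp: neg_indices_def)
    then have "norm (grad s (inner_map r x)) \<le> L_s"
      using grad_s_bound[OF False] by (auto simp: level_set_def)
    then have "0 \<le> L_s"
      using norm_ge_zero order_trans by blast
    then show ?thesis by (simp add: L2_set_nonneg)
  qed simp
  then have cap_le: "?cap \<le> ?h_bar" by simp

  have block: "H \<in> psd_cone" "v \<bullet> (H *v v) \<le> ?cap * (norm v)\<^sup>2"
    if "H \<in> curvature_blocks tC ts Tr h C s r x" for x H v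
    using curvature_block_bound[OF s r_conv h_lipschitz C_lipschitz s_lipschitz r_lipschitz that]
    by auto

  have accepted: "xp \<in> edom ?F" "?L_U \<le> (2 - \<alpha>1) * \<mu> \<Longrightarrow> ereal \<alpha>1 \<le> \<rho>"
    if x: "x \<in> edom ?F" and H: "H \<in> curvature_blocks tC ts Tr h C s r x" and "0 < \<mu>"
      and step: "trial_step g h C s r eps_term (mat \<mu> + H) x xp \<rho>" for x \<mu> H xp \<rho>
  proof -
    \<comment> \<open>A negative weight at \<open>inner_map r x\<close> itself rules out the monotone alternative.\<close>
    have linearized: "r i differentiable (at x)" if "grad s (inner_map r x) $ i < 0" for i
    proof -
      have "\<exists>U. open U \<and> x \<in> U \<and> C1_on U (r i)"
        using monotone_or_smooth x that unfolding monotone_or_smooth_def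
        by (metis linorder_not_less)
      then show ?thesis by (auto simp: C1_on_def)
    qed
    have form: "\<mu> * (norm v)\<^sup>2 \<le> v \<bullet> ((mat \<mu> + H) *v v)" for v
      using block(1)[OF H]
      by (simp add: matrix_vector_mult_add_rdistrib inner_add_right quadratic_form_mat psd_cone_def)
    note acc = trial_step_accepted[OF g h_conv r_conv form _
        model_error[OF C s r_conv h_lipschitz C_lipschitz s_lipschitz r_lipschitz linearized] x step]
    show "xp \<in> edom ?F" "?L_U \<le> (2 - \<alpha>1) * \<mu> \<Longrightarrow> ereal \<alpha>1 \<le> \<rho>"
      using acc[of \<alpha>1] \<open>0 < \<mu>\<close> \<alpha> by auto
  qed

  have run: "x \<in> edom ?F \<and> H \<in> curvature_blocks tC ts Tr h C s r x \<and> Q = mat \<mu> + H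
      \<and> ?q_lo \<le> \<mu> \<and> \<mu> \<le> max \<mu>_min ?\<mu>_bar"
    if "pc_trial g h C s r tC ts Tr x0 \<mu>0 \<mu>_min \<alpha>1 \<alpha>2 \<nu>_inc \<nu>_dec eps_term k x \<mu> H Q"
    for k x \<mu> H Q
    using that
  proof (induction rule: pc_trial.induct)
    case (start H)
    then show ?case using x0 by auto
  next
    case (reject k x \<mu> H Q xp \<rho> \<mu>')
    have "0 < \<mu>" using reject.IH \<mu>0 \<mu>_min by linarith
    then have "\<mu> * (2 - \<alpha>1) < ?L_U"
      using accepted(2)[of x H \<mu> xp \<rho>] reject by (fastforce simp: mult.commute not_le[symmetric])
    then have "\<mu> \<le> ?L_U / (2 - \<alpha>1)"
      using \<alpha> by (simp add: pos_le_divide_eq)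
    then have "\<nu>_inc * \<mu> \<le> \<nu>_inc * (?L_U / (2 - \<alpha>1))"
      using \<nu>_inc by (intro mult_left_mono) auto
    moreover have "\<mu> \<le> \<nu>_inc * \<mu>" using \<open>0 < \<mu>\<close> \<nu>_inc by simp
    ultimately show ?case using reject by auto
  next
    case (accept k x \<mu> H Q xp \<rho> \<mu>' H')
    have "0 < \<mu>" using accept.IH \<mu>0 \<mu>_min by linarith
    then have "xp \<in> edom ?F"
      using accepted(1)[of x H \<mu> xp \<rho>] accept by blast
    moreover have "\<nu>_dec * \<mu> \<le> \<mu>" using \<open>0 < \<mu>\<close> \<nu>_dec by simp
    ultimately show ?case using accept by auto
  qed

  have bounds: "mat ?q_lo \<preceq>\<^sub>L Q \<and> Q \<preceq>\<^sub>L mat (max \<mu>_min ?\<mu>_bar + ?h_bar)"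
    if "pc_trial g h C s r tC ts Tr x0 \<mu>0 \<mu>_min \<alpha>1 \<alpha>2 \<nu>_inc \<nu>_dec eps_term k x \<mu> H Q"
    for k x \<mu> H Q
  proof -
    have H: "H \<in> curvature_blocks tC ts Tr h C s r x" and Q: "Q = mat \<mu> + H"
      and \<mu>: "?q_lo \<le> \<mu>" "\<mu> \<le> max \<mu>_min ?\<mu>_bar"
      using run[OF that] by auto
    show ?thesis
      unfolding Q
      using mat_le_mat_plus[OF block(1)[OF H] \<mu>(1)]
        mat_plus_le_mat[OF block[OF H] add_mono[OF \<mu>(2) cap_le]] by blast
  qed
  have upper: "Q \<preceq>\<^sub>L mat (?\<mu>_bar + ?h_bar)"
    if "pc_trial g h C s r tC ts Tr x0 \<mu>0 \<mu>_min \<alpha>1 \<alpha>2 \<nu>_inc \<nu>_dec eps_term k x \<mu> H Q"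
      and "\<mu>_min \<le> ?\<mu>_bar" for k x \<mu> H Q
    using bounds[OF that(1)] that(2) by (simp add: max_absorb2)
  have "0 < ?q_lo" using \<mu>0 \<mu>_min by simp
  moreover have "?q_lo \<le> ?\<mu>_bar + ?h_bar" using cap_nonneg cap_le by linarith
  ultimately show ?thesis
    unfolding Let_def using bounds upper by blast
qed

end
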